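(* There exists a positive constant $c$ such that for every integer $n\ge 3$ there exists a martingale $(M_k)_{0\le k\le n}$, with respect to some filtration $(\mathcal{F}_k)_{0\le k\le n}$, satisfying, almost surely, $$\mathbb{E}\left[(M_{k+1}-M_k)^2\mid\mathcal{F}_k\right]\ge 1\quad\text{and}\quad |M_{k+1}-M_k|\le\log n$$ for all $0\le k<n$, and yet $$\mathbb{P}(M_n=0)\ge c.$$
   Context: $\log$ denotes the natural logarithm. *)

theory Defs
  imports "HOL-Probability.Probability"
begin

(* The locale filtration of HOL-Probability.Stopping_Time is indexed by a whole type;
   here the index set is {0..n}, and the values of F beyond n are irrelevant. *)
definition filtration_upto :: "'a measure \<Rightarrow> nat \<Rightarrow> (nat \<Rightarrow> 'a measure) \<Rightarrow> bool" where
  "filtration_upto P n F \<longleftrightarrow>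
     (\<forall>k\<le>n. subalgebra P (F k)) \<and>
     (\<forall>j k. j \<le> k \<and> k \<le> n \<longrightarrow> sets (F j) \<subseteq> sets (F k))"

definition martingale_upto ::
    "'a measure \<Rightarrow> nat \<Rightarrow> (nat \<Rightarrow> 'a measure) \<Rightarrow> (nat \<Rightarrow> 'a \<Rightarrow> real) \<Rightarrow> bool" where
  "martingale_upto P n F X \<longleftrightarrow>
     prob_space P \<and> filtration_upto P n F \<and>
     (\<forall>k\<le>n. X k \<in> borel_measurable (F k) \<and> integrable P (X k)) \<and>
     (\<forall>k<n. AE \<omega> in P. real_cond_exp P (F k) (X (Suc k)) \<omega> = X k \<omega>)"

end

theory Submission
  imports Defs "HOL-Real_Asymp.Real_Asymp"
begin

text \<open>
  The martingale is a walk driven by fair signs whose step size is a function of the current position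
  and of the remaining time \<open>t\<close>: fast steps of size \<open>L = ln n\<close> when the walk is farther than about
  \<open>\<surd>t\<close> from the origin, steps of size \<open>1\<close> when it is closer, and in the last step, if the distance
  to the origin lies in \<open>[1, L]\<close>, exactly this distance. As the fast region carries little mass, the
  walk stays within the shrinking ball of radius \<open>\<surd>t\<close> with a probability that does not depend on
  \<open>n\<close>. The probability of ending at the origin is bounded below by a subsolution of the dynamic
  programming inequality that is the maximum of two profiles, a concave one which is a subsolution
  for steps of size \<open>1\<close> and a convex one which is a subsolution for steps of size \<open>L\<close>.
\<close>

section \<open>Step size strategies\<close>

text \<open>The step size \<open>s t x\<close> is the one used at \<open>x\<close> when \<open>t + 1\<close> steps remain.\<close>

primrec win_prob :: "(nat \<Rightarrow> real \<Rightarrow> real) \<Rightarrow> nat \<Rightarrow> real \<Rightarrow> real" where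
  "win_prob s 0 x = of_bool (x = 0)"
| "win_prob s (Suc t) x = (win_prob s t (x + s t x) + win_prob s t (x - s t x)) / 2"

lemma win_prob_cong:
  "(\<And>k. k < t \<Longrightarrow> s k = s' k) \<Longrightarrow> win_prob s t x = win_prob s' t x"
  by (induction t arbitrary: x) auto

text \<open>One strategy must serve all starting points at once, so that it can be extended
  backwards in time. The profile \<open>u\<close> may be negative, which admits unbounded concave
  profiles.\<close>

definition achievable :: "real \<Rightarrow> nat \<Rightarrow> (real \<Rightarrow> real) \<Rightarrow> bool" where
  "achievable L t u \<longleftrightarrow>
     (\<exists>s. (\<forall>k x. 1 \<le> s k x \<and> s k x \<le> L) \<and> (\<forall>x. u x \<le> win_prob s t x))"

lemma achievable_mono:
  "achievable L t u \<Longrightarrow> (\<And>x. v x \<le> u x) \<Longrightarrow> achievable L t v"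
  unfolding achievable_def by (meson order_trans)

lemma achievable_0:
  assumes "1 \<le> L" "\<And>x. u x \<le> of_bool (x = 0)"
  shows "achievable L 0 u"
  unfolding achievable_def using assms by (intro exI[of _ "\<lambda>_ _. 1"]) auto

text \<open>Verification principle: \<open>win_prob s t\<close> consults only the entries
  \<open>s k\<close> with \<open>k < t\<close>, so entry \<open>t\<close> can be overwritten by a
  pointwise choice of \<open>\<sigma>\<close> without affecting what was achieved before.\<close>

lemma achievable_Suc:
  assumes u: "achievable L t u"
    and step: "\<And>x. \<exists>\<sigma>. 1 \<le> \<sigma> \<and> \<sigma> \<le> L \<and> v x \<le> (u (x + \<sigma>) + u (x - \<sigma>)) / 2"
  shows "achievable L (Suc t) v"
proof -
  obtain s where s: "\<And>k x. 1 \<le> s k x \<and> s k x \<le> L" and us: "\<And>x. u x \<le> win_prob s t x"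
    using u unfolding achievable_def by blast
  obtain \<sigma> where \<sigma>: "\<And>x. 1 \<le> \<sigma> x \<and> \<sigma> x \<le> L"
      and v: "\<And>x. v x \<le> (u (x + \<sigma> x) + u (x - \<sigma> x)) / 2"
    using step by metis
  let ?s = "fun_upd s t \<sigma>"
  have eq: "win_prob ?s t x = win_prob s t x" for x
    by (rule win_prob_cong) auto
  have "v x \<le> win_prob ?s (Suc t) x" for x
    using v[of x] us[of "x + \<sigma> x"] us[of "x - \<sigma> x"] by (simp add: eq)
  then show ?thesis
    unfolding achievable_def using s \<sigma> by (intro exI[of _ ?s]) auto
qed

lemma achievable_add:
  assumes "achievable L t (u 0)"
    and "\<And>k x. k < m \<Longrightarrow>
      \<exists>\<sigma>. 1 \<le> \<sigma> \<and> \<sigma> \<le> L \<and> u (Suc k) x \<le> (u k (x + \<sigma>) + u k (x - \<sigma>)) / 2"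
  shows "achievable L (t + m) (u m)"
  using assms(2)
proof (induction m)
  case 0
  then show ?case using assms(1) by simp
next
  case (Suc m)
  show ?case
    using achievable_Suc[OF Suc.IH, of "u (Suc m)"] Suc.prems by simp
qed

section \<open>The final six steps: constant probability on a ball of radius 5 L\<close>

lemma achievable_widen:
  assumes "1 \<le> L" "L \<le> R" "0 \<le> c" and u: "achievable L t (\<lambda>x. c * of_bool (\<bar>x\<bar> \<le> R))"
  shows "achievable L (Suc t) (\<lambda>x. c / 2 * of_bool (\<bar>x\<bar> \<le> R + L))"
proof (rule achievable_Suc[OF u])
  fix x :: real
  \<comment> \<open>The move towards the origin lands in the ball of radius \<open>R\<close>: from
    inside by a step of size 1, from the surrounding shell by a step of size \<open>L\<close>, which
    does not overshoot because \<open>L \<le> R\<close>. It has probability 1/2.\<close>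
  define \<sigma> where "\<sigma> = (if \<bar>x\<bar> \<le> R then 1 else L)"
  have "\<bar>x + \<sigma>\<bar> \<le> R \<or> \<bar>x - \<sigma>\<bar> \<le> R" if "\<bar>x\<bar> \<le> R + L"
    using assms(1,2) that unfolding \<sigma>_def by (auto split: if_splits)
  then have "c / 2 * of_bool (\<bar>x\<bar> \<le> R + L)
      \<le> (c * of_bool (\<bar>x + \<sigma>\<bar> \<le> R) + c * of_bool (\<bar>x - \<sigma>\<bar> \<le> R)) / 2"
    using assms(3) by (cases "\<bar>x\<bar> \<le> R + L") auto
  moreover have "1 \<le> \<sigma>" "\<sigma> \<le> L" using assms(1) by (simp_all add: \<sigma>_def)
  ultimately show "\<exists>\<sigma>. 1 \<le> \<sigma> \<and> \<sigma> \<le> L \<and> c / 2 * of_bool (\<bar>x\<bar> \<le> R + L)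
      \<le> (c * of_bool (\<bar>x + \<sigma>\<bar> \<le> R) + c * of_bool (\<bar>x - \<sigma>\<bar> \<le> R)) / 2"
    by blast
qed

text \<open>The last step jumps exactly onto 0 from distance in \<open>[1, L]\<close>. The step
  before removes the hole around the origin. Four widenings then each add \<open>L\<close> to the
  radius and halve the constant.\<close>

lemma achievable_6:
  assumes "3 \<le> L"
  shows "achievable L 6 (\<lambda>x. 1 / 64 * of_bool (\<bar>x\<bar> \<le> 5 * L))"
proof -
  have "achievable L 0 (\<lambda>x. of_bool (x = 0))"
    using assms by (intro achievable_0) auto
  then have "achievable L (Suc 0) (\<lambda>x. 1 / 2 * of_bool (1 \<le> \<bar>x\<bar> \<and> \<bar>x\<bar> \<le> L))"
    (is "achievable _ _ ?u")
  proof (rule achievable_Suc)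
    fix x :: real
    show "\<exists>\<sigma>. 1 \<le> \<sigma> \<and> \<sigma> \<le> L \<and> ?u x \<le> (of_bool (x + \<sigma> = 0) + of_bool (x - \<sigma> = 0)) / 2"
    proof (cases "1 \<le> \<bar>x\<bar> \<and> \<bar>x\<bar> \<le> L")
      case True
      then show ?thesis by (intro exI[of _ "\<bar>x\<bar>"]) auto
    next
      case False
      then show ?thesis using assms by (intro exI[of _ 1]) auto
    qed
  qed
  then have "achievable L (Suc (Suc 0)) (\<lambda>x. 1 / 4 * of_bool (\<bar>x\<bar> \<le> L))"
  proof (rule achievable_Suc)
    fix x :: real
    \<comment> \<open>Move outwards if \<open>\<bar>x\<bar> \<le> L - 1\<close>, and otherwise
      inwards, where \<open>3 \<le> L\<close> leaves a distance of at least 1.\<close>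
    have "(1 \<le> \<bar>x + 1\<bar> \<and> \<bar>x + 1\<bar> \<le> L) \<or> (1 \<le> \<bar>x - 1\<bar> \<and> \<bar>x - 1\<bar> \<le> L)" if "\<bar>x\<bar> \<le> L"
      using assms that by arith
    then show "\<exists>\<sigma>. 1 \<le> \<sigma> \<and> \<sigma> \<le> L \<and> 1 / 4 * of_bool (\<bar>x\<bar> \<le> L) \<le> (?u (x + \<sigma>) + ?u (x - \<sigma>)) / 2"
      using assms by (intro exI[of _ 1]) auto
  qed
  from achievable_widen[OF _ _ _ this]
  have "achievable L 3 (\<lambda>x. 1 / 8 * of_bool (\<bar>x\<bar> \<le> 2 * L))"
    using assms by (simp add: eval_nat_numeral)
  from achievable_widen[OF _ _ _ this]
  have "achievable L 4 (\<lambda>x. 1 / 16 * of_bool (\<bar>x\<bar> \<le> 3 * L))"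
    using assms by (simp add: eval_nat_numeral)
  from achievable_widen[OF _ _ _ this]
  have "achievable L 5 (\<lambda>x. 1 / 32 * of_bool (\<bar>x\<bar> \<le> 4 * L))"
    using assms by (simp add: eval_nat_numeral)
  from achievable_widen[OF _ _ _ this]
  show ?thesis
    using assms by (simp add: eval_nat_numeral)
qed

section \<open>Subsolutions of the dynamic programming inequality\<close>

definition hat :: "real \<Rightarrow> real \<Rightarrow> real" where
  "hat D x = (max 0 (1 - \<bar>x\<bar> / D))\<^sup>2"

lemma hat_nonneg: "0 \<le> hat D x"
  by (simp add: hat_def)

lemma hat_le_1: "0 < D \<Longrightarrow> hat D x \<le> 1"
  unfolding hat_def by (intro power_le_one) auto

lemma hat_eq_0: "0 < D \<Longrightarrow> D \<le> \<bar>x\<bar> \<Longrightarrow> hat D x = 0"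
  by (simp add: hat_def max_def field_simps)

lemma hat_ge: "0 < D \<Longrightarrow> 1 - 2 * \<bar>x\<bar> / D \<le> hat D x"
proof -
  assume "0 < D"
  have "1 - 2 * y \<le> (max 0 (1 - y))\<^sup>2" if "0 \<le> y" for y :: real
    using that by (cases "y \<le> 1") (auto simp: power2_eq_square algebra_simps max_def)
  from this[of "\<bar>x\<bar> / D"] \<open>0 < D\<close> show ?thesis by (simp add: hat_def)
qed

lemma hat_ge_quarter: "0 < D \<Longrightarrow> \<bar>x\<bar> \<le> D / 2 \<Longrightarrow> 1 / 4 \<le> hat D x"
proof -
  assume "0 < D" "\<bar>x\<bar> \<le> D / 2"
  then have "1 / 2 \<le> max 0 (1 - \<bar>x\<bar> / D)" by (auto simp: field_simps)
  from power_mono[OF this, of 2] show ?thesis by (simp add: hat_def power2_eq_square)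
qed

text \<open>Away from its kink at 0 the squared tent is convex, with second difference of order
  \<open>(L / D)\<^sup>2\<close>; this gain pays for enlarging the support from \<open>D\<close> to
  \<open>D'\<close>. The condition \<open>L \<le> \<bar>x\<bar>\<close> keeps both
  \<open>x + L\<close> and \<open>x - L\<close> on the same side of the kink.\<close>

lemma hat_step:
  assumes L: "0 < L" and D: "5 * L \<le> D" "0 < D'" "D'\<^sup>2 = D\<^sup>2 + 4 * L\<^sup>2" and x: "L \<le> \<bar>x\<bar>"
  shows "hat D' x \<le> (hat D (x + L) + hat D (x - L)) / 2"
proof -
  define y where "y = \<bar>x\<bar>"
  have y: "L \<le> y" using x by (simp add: y_def)
  have sym: "hat D (x + L) + hat D (x - L) = hat D (y + L) + hat D (y - L)"
  proof (cases "0 \<le> x")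
    case False
    then have "\<bar>x + L\<bar> = \<bar>y - L\<bar>" "\<bar>x - L\<bar> = \<bar>y + L\<bar>" unfolding y_def by linarith+
    then show ?thesis by (simp add: hat_def)
  qed (simp add: y_def)
  have "0 < D" using L D by simp
  \<comment> \<open>\<open>e\<close> is the growth of the support radius and \<open>d\<close> the
    signed distance from \<open>y\<close> to the old edge. The cases below are: outside the new
    support, both neighbours in the old support, and only the inner neighbour in it.\<close>
  define e where "e = D' - D"
  define d where "d = D - y"
  have "D \<le> D'" using D(2,3) by (intro power2_le_imp_le[of D D']) simp_all
  then have "0 \<le> e" by (simp add: e_def)
  have e: "e * D \<le> 2 * L\<^sup>2"
  proof -
    have "(D + e)\<^sup>2 = D\<^sup>2 + 4 * L\<^sup>2" using D(3) by (simp add: e_def)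
    then have "e\<^sup>2 + 2 * (e * D) = 4 * L\<^sup>2" by (simp add: power2_sum mult_ac)
    then show ?thesis using zero_le_power2[of e] by linarith
  qed
  have e': "5 * e \<le> 2 * L"
  proof -
    have "e * (5 * L) \<le> e * D" using D(1) \<open>0 \<le> e\<close> by (intro mult_left_mono)
    then have "(5 * e) * L \<le> (2 * L) * L" using e by (simp add: power2_eq_square)
    then show ?thesis using L by simp
  qed
  have "hat D' y \<le> (hat D (y + L) + hat D (y - L)) / 2"
  proof (cases "d + e \<le> 0")
    case True
    then have "hat D' y = 0" using \<open>0 < D'\<close> by (intro hat_eq_0) (auto simp: d_def e_def)
    then show ?thesis using hat_nonneg[of D "y + L"] hat_nonneg[of D "y - L"] by simp
  next
    case False
    then have de: "0 < d + e" by simp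
    have "y < D'" using de by (simp add: d_def e_def)
    have lhs: "hat D' y = (d + e)\<^sup>2 / D'\<^sup>2"
      using \<open>y < D'\<close> y L \<open>0 < D'\<close>
      by (simp add: hat_def d_def e_def max_def diff_divide_distrib flip: power_divide)
    have minus: "hat D (y - L) = (d + L)\<^sup>2 / D\<^sup>2"
    proof -
      have "0 \<le> d + L" using de e' L by linarith
      moreover have "1 - (y - L) / D = (d + L) / D"
        using \<open>0 < D\<close> by (simp add: d_def field_simps)
      ultimately show ?thesis using y \<open>0 < D\<close> by (simp add: hat_def power_divide)
    qed
    show ?thesis
    proof (cases "L \<le> d")
      case True
      have "1 - (y + L) / D = (d - L) / D"
        using \<open>0 < D\<close> by (simp add: d_def field_simps)
      then have plus: "hat D (y + L) = (d - L)\<^sup>2 / D\<^sup>2"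
        using y L \<open>0 < D\<close> True by (simp add: hat_def power_divide)
      \<comment> \<open>Cauchy--Schwarz for the vectors \<open>(d, L)\<close> and \<open>(1, e / L)\<close>\<close>
      have "L\<^sup>2 * (d + e)\<^sup>2 \<le> (d\<^sup>2 + L\<^sup>2) * (L\<^sup>2 + e\<^sup>2)"
      proof -
        have "(d\<^sup>2 + L\<^sup>2) * (L\<^sup>2 + e\<^sup>2) - L\<^sup>2 * (d + e)\<^sup>2 = (d * e - L\<^sup>2)\<^sup>2"
          by algebra
        then show ?thesis by (metis diff_ge_0_iff_ge zero_le_power2)
      qed
      then have "D\<^sup>2 * (L\<^sup>2 * (d + e)\<^sup>2) \<le> (d\<^sup>2 + L\<^sup>2) * (D\<^sup>2 * (L\<^sup>2 + e\<^sup>2))"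
        by (metis mult.left_commute mult_left_mono zero_le_power2)
      also have "\<dots> \<le> (d\<^sup>2 + L\<^sup>2) * (L\<^sup>2 * D'\<^sup>2)"
      proof (rule mult_left_mono)
        \<comment> \<open>Expanding \<open>D'\<^sup>2\<close>, the goal is equivalent to this bound;
          it is where the 4 in the recursion for \<open>D'\<close> is spent.\<close>
        have "(e * D)\<^sup>2 \<le> (2 * L\<^sup>2)\<^sup>2"
          using e \<open>0 \<le> e\<close> \<open>0 < D\<close> by (intro power_mono) auto
        then show "D\<^sup>2 * (L\<^sup>2 + e\<^sup>2) \<le> L\<^sup>2 * D'\<^sup>2"
          unfolding D(3) by (simp add: power2_eq_square algebra_simps)
      qed simp
      finally have "D\<^sup>2 * (d + e)\<^sup>2 \<le> (d\<^sup>2 + L\<^sup>2) * D'\<^sup>2"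
        using L by (simp add: mult.left_commute)
      then have "(d + e)\<^sup>2 / D'\<^sup>2 \<le> (d\<^sup>2 + L\<^sup>2) / D\<^sup>2"
        using \<open>0 < D\<close> \<open>0 < D'\<close> by (simp add: field_simps)
      also have "\<dots> = ((d - L)\<^sup>2 / D\<^sup>2 + (d + L)\<^sup>2 / D\<^sup>2) / 2"
      proof -
        have "(d - L)\<^sup>2 + (d + L)\<^sup>2 = 2 * (d\<^sup>2 + L\<^sup>2)"
          by (simp add: power2_diff power2_sum)
        moreover have "p / q = 2 * p / q / 2" for p q :: real by simp
        ultimately show ?thesis by (metis add_divide_distrib)
      qed
      finally show ?thesis by (simp add: lhs plus minus)
    next
      case False
      \<comment> \<open>Only the inner neighbour counts, with weight 1/2. From \<open>d < L\<close>
        and \<open>5 * e \<le> 2 * L\<close> the ratio of \<open>d + e\<close> to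
        \<open>d + L\<close> is at most 7/10, whose square is below 1/2.\<close>
      have "10 * (d + e) \<le> 7 * (d + L)"
        using False e' by simp
      then have "(10 * (d + e))\<^sup>2 \<le> (7 * (d + L))\<^sup>2"
        using de by (intro power_mono) auto
      then have "100 * (d + e)\<^sup>2 \<le> 49 * (d + L)\<^sup>2"
        unfolding power_mult_distrib by simp
      then have "(d + e)\<^sup>2 \<le> (d + L)\<^sup>2 / 2" using zero_le_power2[of "d + L"] by linarith
      moreover have "D\<^sup>2 \<le> D'\<^sup>2" using D(3) by simp
      ultimately have "(d + e)\<^sup>2 / D'\<^sup>2 \<le> (d + L)\<^sup>2 / 2 / D\<^sup>2"
        using \<open>0 < D\<close> by (intro frac_le) auto
      also have "\<dots> = hat D (y - L) / 2" by (simp add: minus)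
      finally show ?thesis
        unfolding lhs add_divide_distrib using hat_nonneg[of D "y + L"] by linarith
    qed
  qed
  then show ?thesis using sym by (simp add: hat_def y_def)
qed

section \<open>Two phases of growth backwards in time\<close>

text \<open>This phase enlarges the radius from order \<open>L\<close> to order
  \<open>L\<^sup>2\<close> over a time of order \<open>L\<^sup>2\<close>, at the cost of a constant
  factor. Near the origin the quadratic \<open>f\<close> is preserved exactly by steps of size 1;
  elsewhere \<open>hat_step\<close> takes over.\<close>

lemma achievable_hat_phase:
  assumes L: "3 \<le> L" and m: "real m \<le> 11 * L\<^sup>2"
  shows "achievable L (6 + m) (\<lambda>x. 1 / 128 * hat (L * sqrt (25 + 4 * real m)) x)"
proof -
  define D where "D k = L * sqrt (25 + 4 * real k)" for k
  define f where "f k x = 1 - (x\<^sup>2 + real k) / (25 * L\<^sup>2)" for k x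
  define u where "u k x = 1 / 64 * max (f k x) (1 / 2 * hat (D k) x)" for k x
  have D: "0 < D k" "5 * L \<le> D k" "(D (Suc k))\<^sup>2 = (D k)\<^sup>2 + 4 * L\<^sup>2" for k
  proof -
    show "0 < D k" using L by (simp add: D_def)
    have "5 \<le> sqrt (25 + 4 * real k)" by (rule real_le_rsqrt) simp
    then have "L * 5 \<le> L * sqrt (25 + 4 * real k)" using L by (intro mult_left_mono) auto
    then show "5 * L \<le> D k" by (simp add: D_def)
    show "(D (Suc k))\<^sup>2 = (D k)\<^sup>2 + 4 * L\<^sup>2"
      by (simp add: D_def power_mult_distrib algebra_simps)
  qed
  have "achievable L (6 + m) (u m)"
  proof (rule achievable_add)
    show "achievable L 6 (u 0)"
    proof (rule achievable_mono[OF achievable_6[OF L]])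
      fix x
      show "u 0 x \<le> 1 / 64 * of_bool (\<bar>x\<bar> \<le> 5 * L)"
      proof (cases "\<bar>x\<bar> \<le> 5 * L")
        case True
        then show ?thesis using hat_le_1[OF D(1), of 0 x] by (simp add: u_def f_def)
      next
        case False
        have "(5 * L)\<^sup>2 \<le> \<bar>x\<bar>\<^sup>2" using False L by (intro power_mono) auto
        then have "f 0 x \<le> 0" using L by (simp add: f_def power_mult_distrib)
        moreover have "hat (D 0) x = 0"
          using False L by (intro hat_eq_0) (auto simp: D_def)
        ultimately show ?thesis using False by (simp add: u_def)
      qed
    qed
  next
    fix k x assume "k < m"
    show "\<exists>\<sigma>. 1 \<le> \<sigma> \<and> \<sigma> \<le> L \<and> u (Suc k) x \<le> (u k (x + \<sigma>) + u k (x - \<sigma>)) / 2"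
    proof (cases "1 / 2 * hat (D (Suc k)) x \<le> f (Suc k) x")
      case True
      have "f (Suc k) x = (f k (x + 1) + f k (x - 1)) / 2"
        using L by (simp add: f_def field_simps power2_eq_square)
      then have "u (Suc k) x \<le> (u k (x + 1) + u k (x - 1)) / 2"
        using True by (simp add: u_def)
      then show ?thesis using L by (intro exI[of _ 1]) simp
    next
      case False
      \<comment> \<open>Where \<open>f\<close> loses to half the hat, it is below 1/2, so
        \<open>x\<^sup>2\<close> plus the elapsed time exceeds 25/2 times \<open>L\<^sup>2\<close>.
        As the time is at most 11 times \<open>L\<^sup>2\<close>, the point is at distance at least
        \<open>L\<close>, as \<open>hat_step\<close> requires.\<close>
      have "f (Suc k) x < 1 / 2" using False hat_le_1[OF D(1), of "Suc k" x] by simp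
      then have "25 * L\<^sup>2 / 2 < x\<^sup>2 + real (Suc k)" using L by (simp add: f_def field_simps)
      moreover have "real (Suc k) \<le> real m" using \<open>k < m\<close> by simp
      ultimately have "L\<^sup>2 \<le> x\<^sup>2" using m zero_le_power2[of L] by linarith
      then have "L \<le> \<bar>x\<bar>" using L by (simp flip: abs_le_square_iff)
      then have "hat (D (Suc k)) x \<le> (hat (D k) (x + L) + hat (D k) (x - L)) / 2"
        using L D by (intro hat_step) auto
      then have "u (Suc k) x \<le> (u k (x + L) + u k (x - L)) / 2"
        using False by (simp add: u_def)
      then show ?thesis using L by (intro exI[of _ L]) simp
    qed
  qed
  then show ?thesis
    by (rule achievable_mono) (simp add: u_def D_def)
qed

text \<open>The scale \<open>\<surd>t\<close> is diffusive for the slow walk: within one doubling of the remaining time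
  \<open>t\<close>, only a fraction \<open>O(1 / L)\<close> of the mass escapes from the ball of that radius to the region of
  fast steps, which live on the scale \<open>L \<surd>t\<close>. This is the exponent \<open>40 / L\<close>; since
  \<open>t \<le> exp L\<close>, the total loss is a constant.\<close>

lemma achievable_power_phase:
  assumes L: "8 \<le> L" and c: "0 \<le> c"
    and start: "achievable L t0 (\<lambda>x. c * of_bool (\<bar>x\<bar> \<le> 2 * L\<^sup>2))"
  shows "achievable L (t0 + m) (\<lambda>x. c * exp (- 40 / L * ln (L\<^sup>2 + m)) * (1 - x\<^sup>2 / (L * (L\<^sup>2 + m))))"
proof -
  define T where "T k = L\<^sup>2 + real k" for k
  define D where "D k = 2 * L * sqrt (T k)" for k
  define a where "a k = exp (- 40 / L * ln (T k))" for k
  define f where "f k x = 1 - x\<^sup>2 / (L * T k)" for k x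
  define g where "g k x = (1 - 1 / L) * hat (D k) x" for k x
  define u where "u k x = c * (a k * max (f k x) (g k x))" for k x
  have L2: "8 * L \<le> L\<^sup>2" using L by (simp add: power2_eq_square)
  have T: "L\<^sup>2 \<le> T k" "64 \<le> T k" "0 < T k" "T (Suc k) = T k + 1" for k
    using L2 L by (auto simp: T_def)
  have sqrtT: "L \<le> sqrt (T k)" for k using T(1) by (rule real_le_rsqrt)
  have D: "0 < D k" "5 * L \<le> D k" "(D (Suc k))\<^sup>2 = (D k)\<^sup>2 + 4 * L\<^sup>2" for k
  proof -
    show "0 < D k" using L T(3) by (simp add: D_def)
    have "2 * L * L \<le> D k" unfolding D_def using sqrtT L by (intro mult_left_mono) auto
    then show "5 * L \<le> D k" using L2 L unfolding power2_eq_square by linarith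
    show "(D (Suc k))\<^sup>2 = (D k)\<^sup>2 + 4 * L\<^sup>2"
      using T(3)[of k] by (simp add: D_def power_mult_distrib T(4) algebra_simps)
  qed
  have a: "0 < a k" for k by (simp add: a_def)
  \<comment> \<open>The exponent 40 is halved twice: by bounding the increment of
    \<open>ln (T k)\<close> below by 1 / (2 T), and by bounding exp (-h) above by 1 - h / 2. The
    remaining 10 is halved once more below by \<open>f \<ge> 1 / 2\<close>, leaving 5.\<close>
  have a_Suc: "a (Suc k) \<le> a k * (1 - 10 / (L * T k))" for k
  proof -
    define h where "h = 20 / (L * T k)"
    have "8 * 64 \<le> L * T k" using L T(2) by (intro mult_mono) auto
    then have h: "0 \<le> h" "h \<le> 1" by (auto simp: h_def field_simps)
    have "1 / (2 * T k) \<le> 1 - T k / T (Suc k)"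
      using T(2)[of k] by (simp add: T(4) field_simps)
    also have "\<dots> \<le> - ln (T k / T (Suc k))"
      using ln_le_minus_one[of "T k / T (Suc k)"] T(3) by simp
    also have "\<dots> = ln (T (Suc k)) - ln (T k)"
      using T(3)[of k] T(3)[of "Suc k"] by (simp add: ln_div)
    finally have "40 / L * (1 / (2 * T k)) \<le> 40 / L * (ln (T (Suc k)) - ln (T k))"
      using L by (intro mult_left_mono) auto
    then have "a (Suc k) \<le> exp (- 40 / L * ln (T k) + - h)"
      unfolding a_def h_def by (simp add: right_diff_distrib diff_divide_distrib mult.commute)
    also have "\<dots> = a k * exp (- h)" by (simp only: exp_add a_def)
    also have "exp (- h) \<le> 1 / (1 + h)"
      using h exp_ge_add_one_self[of h] by (simp add: exp_minus field_simps)
    also have "1 / (1 + h) \<le> 1 - h / 2"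
      using h mult_left_mono[OF h(2) h(1)] by (simp add: field_simps)
    finally show ?thesis using a[of k] by (simp add: h_def)
  qed
  have a_mono: "a (Suc k) \<le> a k" for k
  proof -
    have "0 \<le> a k * (10 / (L * T k))" using a[of k] T(3)[of k] L by simp
    then show ?thesis using a_Suc[of k] by (simp add: right_diff_distrib)
  qed
  \<comment> \<open>In the variable \<open>y\<close> the comparison is between 1 - y^2 / L and a
    lower bound for \<open>g\<close> coming from the tangent of the hat; beyond \<open>y = 2\<close>
    the quadratic is the smaller one.\<close>
  have far: "x\<^sup>2 \<le> 4 * T k" if "g k x \<le> f k x" for k x
  proof (rule ccontr)
    define y where "y = \<bar>x\<bar> / sqrt (T k)"
    assume "\<not> x\<^sup>2 \<le> 4 * T k"
    then have "2\<^sup>2 < y\<^sup>2" using T(3)[of k] by (simp add: y_def power_divide field_simps)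
    then have y: "2 < y" using power2_less_imp_less[of 2 y] T(3)[of k] by (simp add: y_def)
    have "1 - y / L \<le> hat (D k) x"
      using hat_ge[OF D(1), of x k] L T(3)[of k] by (simp add: y_def D_def field_simps)
    then have "(1 - 1 / L) * (1 - y / L) \<le> g k x"
      unfolding g_def using L by (intro mult_left_mono) auto
    moreover have "f k x = 1 - y\<^sup>2 / L"
      using T(3)[of k] by (simp add: f_def y_def power_divide)
    ultimately have "(1 - 1 / L) * (1 - y / L) \<le> 1 - y\<^sup>2 / L" using that by simp
    then have "L * (L * y\<^sup>2 + y) \<le> L * (L * y + L)"
      using L by (simp add: field_simps power2_eq_square)
    then have "L * y\<^sup>2 + y \<le> L * y + L" using L by simp
    moreover have "L * (2 * y) \<le> L * y\<^sup>2"
      using y L by (intro mult_left_mono) (auto simp: power2_eq_square)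
    moreover have "L * 2 \<le> L * y" using y L by simp
    ultimately show False using y L by linarith
  qed
  have "achievable L (t0 + m) (u m)"
  proof (rule achievable_add)
    show "achievable L t0 (u 0)"
    proof (rule achievable_mono[OF start])
      fix x
      have "a 0 * max (f 0 x) (g 0 x) \<le> of_bool (\<bar>x\<bar> \<le> 2 * L\<^sup>2)"
      proof (cases "\<bar>x\<bar> \<le> 2 * L\<^sup>2")
        case True
        have "f 0 x \<le> 1" using T(3)[of 0] L by (simp add: f_def)
        moreover have "g 0 x \<le> 1"
          unfolding g_def using L hat_nonneg[of "D 0" x] hat_le_1[OF D(1), of 0 x]
          by (intro mult_le_one) auto
        moreover have "0 \<le> g 0 x" unfolding g_def using L hat_nonneg by (intro mult_nonneg_nonneg) auto
        moreover have "a 0 \<le> 1" using T(2)[of 0] L by (simp add: a_def)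
        ultimately have "a 0 * max (f 0 x) (g 0 x) \<le> 1"
          using a[of 0] by (intro mult_le_one) auto
        then show ?thesis using True by simp
      next
        case False
        have "D 0 = 2 * L\<^sup>2" using L by (simp add: D_def T_def power2_eq_square)
        then have "g 0 x = 0" using False D(1)[of 0] by (simp add: g_def hat_eq_0)
        moreover have "f 0 x \<le> 0"
        proof -
          have "L * L\<^sup>2 \<le> L\<^sup>2 * L\<^sup>2" using L2 L by (intro mult_right_mono) auto
          also have "\<dots> \<le> \<bar>x\<bar> * \<bar>x\<bar>" using False by (intro mult_mono) auto
          finally have "L * L\<^sup>2 \<le> x\<^sup>2" by (simp add: power2_eq_square)
          then show ?thesis using L by (simp add: f_def T_def)
        qed
        ultimately show ?thesis using False by simp
      qed
      then show "u 0 x \<le> c * of_bool (\<bar>x\<bar> \<le> 2 * L\<^sup>2)"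
        unfolding u_def using c by (intro mult_left_mono)
    qed
  next
    fix k x assume "k < m"
    have "\<exists>\<sigma>. 1 \<le> \<sigma> \<and> \<sigma> \<le> L \<and> a (Suc k) * max (f (Suc k) x) (g (Suc k) x)
        \<le> (a k * max (f k (x + \<sigma>)) (g k (x + \<sigma>)) + a k * max (f k (x - \<sigma>)) (g k (x - \<sigma>))) / 2"
      (is "\<exists>\<sigma>. _ \<and> _ \<and> ?lhs \<le> ?rhs \<sigma>")
    proof (cases "g (Suc k) x \<le> f (Suc k) x")
      case True
      note x = far[OF True]
      have LT: "0 < L * T k" "0 < L * T (Suc k)" using L T(3) by auto
      have half: "1 / 2 \<le> f (Suc k) x"
      proof -
        have "8 * T (Suc k) \<le> L * T (Suc k)"
          using L T(3)[of "Suc k"] by (intro mult_right_mono) auto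
        then have "2 * x\<^sup>2 \<le> L * T (Suc k)" using x by linarith
        then show ?thesis using LT(2) by (simp add: f_def field_simps)
      qed
      \<comment> \<open>Two losses must be covered by the 5 / (L T) gained from \<open>a\<close>: 1
        / (L T) from the concavity of \<open>f\<close>, and at most 4 / (L T) from its widening in
        time, by \<open>far\<close>.\<close>
      have avg: "(f k (x + 1) + f k (x - 1)) / 2 = f k x - 1 / (L * T k)"
        by (simp add: f_def power2_sum power2_diff add_divide_distrib diff_divide_distrib)
      have diff: "f (Suc k) x - f k x \<le> 4 / (L * T k)"
      proof -
        have "f (Suc k) x - f k x = x\<^sup>2 / (L * T k) - x\<^sup>2 / (L * T (Suc k))"
          by (simp add: f_def)
        also have "\<dots> = x\<^sup>2 / T (Suc k) / (L * T k)"
          using L T(3)[of k] T(3)[of "Suc k"]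
          by (simp add: field_simps) (simp add: T(4) algebra_simps)
        also have "\<dots> \<le> 4 / (L * T k)"
          using x LT(1) T(3)[of "Suc k"] by (intro divide_right_mono) (auto simp: field_simps)
        finally show ?thesis .
      qed
      have "a (Suc k) * f (Suc k) x \<le> a k * (1 - 10 / (L * T k)) * f (Suc k) x"
        using half a_Suc by (intro mult_right_mono) auto
      also have "\<dots> = a k * (f (Suc k) x - 10 / (L * T k) * f (Suc k) x)"
        by (simp add: algebra_simps)
      also have "\<dots> \<le> a k * (f k x - 1 / (L * T k))"
      proof (rule mult_left_mono)
        have "10 / (L * T k) * (1 / 2) \<le> 10 / (L * T k) * f (Suc k) x"
          using half LT(1) by (intro mult_left_mono) auto
        then show "f (Suc k) x - 10 / (L * T k) * f (Suc k) x \<le> f k x - 1 / (L * T k)"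
          using diff by simp
      qed (use a in \<open>simp add: less_imp_le\<close>)
      also have "\<dots> = (a k * f k (x + 1) + a k * f k (x - 1)) / 2"
        using avg by (simp add: distrib_left flip: avg)
      also have "\<dots> \<le> ?rhs 1"
        using a[of k] by (intro divide_right_mono add_mono mult_left_mono) auto
      finally have "?lhs \<le> ?rhs 1" using True by (simp add: max_def)
      then show ?thesis using L by (intro exI[of _ 1]) simp
    next
      case False
      have "L \<le> \<bar>x\<bar>"
      proof (rule ccontr)
        assume "\<not> L \<le> \<bar>x\<bar>"
        then have "\<bar>x\<bar>\<^sup>2 \<le> L\<^sup>2" by (intro power_mono) auto
        then have "x\<^sup>2 / (L * T (Suc k)) \<le> T (Suc k) / (L * T (Suc k))"
          using T(1)[of "Suc k"] T(3)[of "Suc k"] L by (intro divide_right_mono) auto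
        then have "1 - 1 / L \<le> f (Suc k) x"
          using T(3)[of "Suc k"] by (simp add: f_def)
        moreover have "g (Suc k) x \<le> 1 - 1 / L"
          unfolding g_def using L hat_le_1[OF D(1), of "Suc k" x]
          by (intro mult_left_le) auto
        ultimately show False using False by simp
      qed
      then have "hat (D (Suc k)) x \<le> (hat (D k) (x + L) + hat (D k) (x - L)) / 2"
        using L D by (intro hat_step) auto
      then have "g (Suc k) x \<le> (1 - 1 / L) * ((hat (D k) (x + L) + hat (D k) (x - L)) / 2)"
        unfolding g_def using L by (intro mult_left_mono) auto
      then have g: "g (Suc k) x \<le> (g k (x + L) + g k (x - L)) / 2"
        by (simp add: g_def distrib_left)
      have "0 \<le> g (Suc k) x"
        unfolding g_def using L hat_nonneg by (intro mult_nonneg_nonneg) auto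
      then have "a (Suc k) * g (Suc k) x \<le> a k * ((g k (x + L) + g k (x - L)) / 2)"
        using a_mono g a[of k] by (intro mult_mono) auto
      also have "\<dots> = (a k * g k (x + L) + a k * g k (x - L)) / 2"
        by (simp add: distrib_left)
      also have "\<dots> \<le> ?rhs L"
        using a[of k] by (intro divide_right_mono add_mono mult_left_mono) auto
      finally have "?lhs \<le> ?rhs L" using False by (simp add: max_def)
      then show ?thesis using L by (intro exI[of _ L]) simp
    qed
    then obtain \<sigma> where \<sigma>: "1 \<le> \<sigma>" "\<sigma> \<le> L" "?lhs \<le> ?rhs \<sigma>" by blast
    have "c * ?lhs \<le> c * ?rhs \<sigma>" using \<sigma>(3) c by (rule mult_left_mono)
    then have "u (Suc k) x \<le> (u k (x + \<sigma>) + u k (x - \<sigma>)) / 2"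
      by (simp add: u_def distrib_left)
    then show "\<exists>\<sigma>. 1 \<le> \<sigma> \<and> \<sigma> \<le> L \<and> u (Suc k) x \<le> (u k (x + \<sigma>) + u k (x - \<sigma>)) / 2"
      using \<sigma> by blast
  qed
  then show ?thesis
  proof (rule achievable_mono)
    fix x
    have "c * (a m * f m x) \<le> u m x"
      unfolding u_def using c a[of m] by (intro mult_left_mono) auto
    then show "c * exp (- 40 / L * ln (L\<^sup>2 + m)) * (1 - x\<^sup>2 / (L * (L\<^sup>2 + m))) \<le> u m x"
      by (simp add: a_def f_def T_def mult.assoc)
  qed
qed

section \<open>Assembling the phases into a bound uniform in n\<close>

text \<open>The \<open>n\<close> steps split into 6 final ones, \<open>k\<close> of the hat phase
  and the rest in the power phase. With \<open>k\<close> about four times \<open>L\<^sup>2\<close>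
  the hat has radius at least \<open>4 * L\<^sup>2\<close>, and it is at least 1/4 on half of that
  radius. Finally \<open>L\<^sup>2 \<le> k\<close> keeps the shifted time below
  \<open>n = exp L\<close>, so the loss is at most the factor exp (-40).\<close>

lemma achievable_log:
  assumes L: "8 \<le> L" "L = ln (real n)" and n: "7 + 4 * L\<^sup>2 \<le> real n"
  shows "\<exists>u. achievable L n u \<and> 1 / 512 * exp (- 40) \<le> u 0"
proof -
  define k where "k = nat \<lceil>4 * L\<^sup>2\<rceil>"
  have k: "4 * L\<^sup>2 \<le> real k" "real k \<le> 4 * L\<^sup>2 + 1"
  proof -
    have "0 \<le> 4 * L\<^sup>2" by simp
    then show "4 * L\<^sup>2 \<le> real k" "real k \<le> 4 * L\<^sup>2 + 1" unfolding k_def by linarith+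
  qed
  have "8\<^sup>2 \<le> L\<^sup>2" using L(1) by (intro power_mono) auto
  have "achievable L (6 + k) (\<lambda>x. 1 / 128 * hat (L * sqrt (25 + 4 * real k)) x)"
    using L k \<open>8\<^sup>2 \<le> L\<^sup>2\<close> by (intro achievable_hat_phase) auto
  then have "achievable L (6 + k) (\<lambda>x. 1 / 512 * of_bool (\<bar>x\<bar> \<le> 2 * L\<^sup>2))"
  proof (rule achievable_mono)
    fix x
    let ?D = "L * sqrt (25 + 4 * real k)"
    have D: "0 < ?D" using L by simp
    have "4 * L \<le> sqrt (25 + 4 * real k)"
      using k by (intro real_le_rsqrt) (simp add: power_mult_distrib)
    then have "L * (4 * L) \<le> ?D" using L by (intro mult_left_mono) auto
    then have "1 / 4 \<le> hat ?D x" if "\<bar>x\<bar> \<le> 2 * L\<^sup>2"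
      using that D by (intro hat_ge_quarter) (auto simp: power2_eq_square)
    then show "1 / 512 * of_bool (\<bar>x\<bar> \<le> 2 * L\<^sup>2) \<le> 1 / 128 * hat ?D x"
      using hat_nonneg[of ?D x] by (cases "\<bar>x\<bar> \<le> 2 * L\<^sup>2") auto
  qed
  from achievable_power_phase[OF L(1) _ this, of "n - (6 + k)"]
  have *: "achievable L (6 + k + (n - (6 + k)))
      (\<lambda>x. 1 / 512 * exp (- 40 / L * ln (L\<^sup>2 + real (n - (6 + k))))
        * (1 - x\<^sup>2 / (L * (L\<^sup>2 + real (n - (6 + k))))))" (is "achievable _ _ ?u") by simp
  have "real (6 + k) \<le> real n" using k n by simp
  then have le: "6 + k \<le> n" by linarith
  then have "L\<^sup>2 + real (n - (6 + k)) \<le> real n"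
    using k \<open>8\<^sup>2 \<le> L\<^sup>2\<close> by (simp add: of_nat_diff)
  moreover have "0 < L\<^sup>2 + real (n - (6 + k))" using \<open>8\<^sup>2 \<le> L\<^sup>2\<close> by simp
  ultimately have "ln (L\<^sup>2 + real (n - (6 + k))) \<le> ln (real n)" by (intro ln_mono)
  then have "ln (L\<^sup>2 + real (n - (6 + k))) \<le> L" by (simp only: L(2))
  then have "40 / L * ln (L\<^sup>2 + real (n - (6 + k))) \<le> 40 / L * L"
    using L(1) by (intro mult_left_mono) auto
  then have "1 / 512 * exp (- 40) \<le> ?u 0" using L(1) by simp
  then show ?thesis using * le by auto
qed

text \<open>For small \<open>n\<close>: unit steps from \<open>n\<close> reach 0 along the path of
  \<open>n\<close> steps down.\<close>

lemma achievable_one: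
  assumes "1 \<le> L"
  shows "\<exists>u. achievable L n u \<and> (1 / 2) ^ n \<le> u (real n)"
proof -
  have pos: "0 \<le> win_prob (\<lambda>_ _. 1) k x" for k x
    by (induction k arbitrary: x) auto
  have "(1 / 2) ^ n \<le> win_prob (\<lambda>_ _. 1) n (real n)"
  proof (induction n)
    case (Suc n)
    then show ?case using pos[of n "2 + real n"] by (simp add: algebra_simps)
  qed simp
  moreover have "achievable L n (win_prob (\<lambda>_ _. 1) n)"
    unfolding achievable_def using assms by (intro exI[of _ "\<lambda>_ _. 1"]) auto
  ultimately show ?thesis by blast
qed

lemma ex_uniform_bound:
  "\<exists>c>0. \<forall>n\<ge>3. \<exists>u x. achievable (ln (real n)) n u \<and> c \<le> u x"
proof -
  have "\<forall>\<^sub>F n in sequentially. 8 \<le> ln (real n) \<and> 7 + 4 * (ln (real n))\<^sup>2 \<le> real n"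
    by (intro eventually_conj; real_asymp)
  then obtain N where N: "\<And>n. N \<le> n \<Longrightarrow> 8 \<le> ln (real n) \<and> 7 + 4 * (ln (real n))\<^sup>2 \<le> real n"
    by (auto simp: eventually_sequentially)
  define c :: real where "c = min (1 / 512 * exp (- 40)) ((1 / 2) ^ N)"
  have "\<exists>u x. achievable (ln (real n)) n u \<and> c \<le> u x" if "3 \<le> n" for n
  proof (cases "N \<le> n")
    case True
    then obtain u where "achievable (ln (real n)) n u" "1 / 512 * exp (- 40) \<le> u 0"
      using achievable_log[of "ln (real n)" n] N[of n] by auto
    moreover have "c \<le> 1 / 512 * exp (- 40)" by (simp add: c_def)
    ultimately show ?thesis by (meson order_trans)
  next
    case False
    have "exp 1 \<le> real n" using exp_le that by linarith
    then have "1 \<le> ln (real n)" using that by (subst ln_ge_iff) auto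
    then obtain u where u: "achievable (ln (real n)) n u" "(1 / 2) ^ n \<le> u (real n)"
      using achievable_one by blast
    have "((1::real) / 2) ^ N \<le> (1 / 2) ^ n" using False by (intro power_decreasing) auto
    then have "c \<le> (1 / 2) ^ n" unfolding c_def by (rule min.coboundedI2)
    then show ?thesis using u by (meson order_trans)
  qed
  moreover have "0 < c" by (simp add: c_def)
  ultimately show ?thesis by blast
qed

section \<open>The controlled walk driven by fair signs\<close>

text \<open>Coordinates from \<open>n\<close> on are pinned to 0, so that the set is finite and
  carries a uniform distribution.\<close>

definition sign_vectors :: "nat \<Rightarrow> (nat \<Rightarrow> real) set" where
  "sign_vectors n = {\<omega>. (\<forall>i<n. \<bar>\<omega> i\<bar> = 1) \<and> (\<forall>i\<ge>n. \<omega> i = 0)}"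

lemma finite_sign_vectors: "finite (sign_vectors n)"
proof -
  have "sign_vectors n \<subseteq> (\<lambda>A i. if i < n then if i \<in> A then 1 else - 1 else 0) ` Pow {..<n}"
  proof
    fix \<omega> assume "\<omega> \<in> sign_vectors n"
    then show "\<omega> \<in> (\<lambda>A i. if i < n then if i \<in> A then 1 else - 1 else 0) ` Pow {..<n}"
      by (intro image_eqI[of _ _ "{i. i < n \<and> \<omega> i = 1}"])
         (fastforce simp: sign_vectors_def fun_eq_iff abs_eq_iff not_less)+
  qed
  then show ?thesis by (rule finite_subset) simp
qed

lemma sign_vectors_nonempty: "sign_vectors n \<noteq> {}"
proof -
  have "(\<lambda>i. if i < n then 1 else 0) \<in> sign_vectors n" by (simp add: sign_vectors_def)
  then show ?thesis by blast
qed

definition signs_pmf :: "nat \<Rightarrow> (nat \<Rightarrow> real) pmf" where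
  "signs_pmf n = pmf_of_set (sign_vectors n)"

lemma set_signs_pmf: "set_pmf (signs_pmf n) = sign_vectors n"
  unfolding signs_pmf_def by (intro set_pmf_of_set sign_vectors_nonempty finite_sign_vectors)

lemma integrable_signs_pmf [simp]:
  fixes f :: "(nat \<Rightarrow> real) \<Rightarrow> real"
  shows "integrable (measure_pmf (signs_pmf n)) f"
  by (intro integrable_measure_pmf_finite) (simp add: set_signs_pmf finite_sign_vectors)

text \<open>A measure-preserving involution; its symmetry replaces independence of the signs in all
  expectations below.\<close>

definition flip :: "nat \<Rightarrow> (nat \<Rightarrow> real) \<Rightarrow> nat \<Rightarrow> real" where
  "flip k \<omega> = fun_upd \<omega> k (- \<omega> k)"

lemma map_pmf_flip: "map_pmf (flip k) (signs_pmf n) = signs_pmf n"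
proof -
  have inv: "flip k (flip k \<omega>) = \<omega>" for \<omega> by (simp add: flip_def)
  have mem: "\<omega> \<in> sign_vectors n \<Longrightarrow> flip k \<omega> \<in> sign_vectors n" for \<omega>
    by (auto simp: sign_vectors_def flip_def)
  have inj: "inj_on (flip k) (sign_vectors n)"
    by (metis inv inj_onI)
  have img: "flip k ` sign_vectors n = sign_vectors n"
    using inv mem by (metis (no_types, lifting) image_iff subsetI subset_antisym image_subsetI)
  show ?thesis
    unfolding signs_pmf_def
    by (subst map_pmf_of_set_inj[OF inj sign_vectors_nonempty finite_sign_vectors]) (simp add: img)
qed

lemma expectation_flip:
  fixes f :: "(nat \<Rightarrow> real) \<Rightarrow> real"
  shows "measure_pmf.expectation (signs_pmf n) (\<lambda>\<omega>. f (flip k \<omega>))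
       = measure_pmf.expectation (signs_pmf n) f"
  by (subst (2) map_pmf_flip[of k n, symmetric]) simp

text \<open>The events determined by the first \<open>k\<close> signs. They already form a
  sigma-algebra, so every function of these signs is measurable.\<close>

definition coin_filtration :: "nat \<Rightarrow> (nat \<Rightarrow> real) measure" where
  "coin_filtration k = sigma UNIV {A. \<forall>\<omega> \<omega>'. (\<forall>i<k. \<omega> i = \<omega>' i) \<longrightarrow> (\<omega> \<in> A \<longleftrightarrow> \<omega>' \<in> A)}"

lemma space_coin_filtration [simp]: "space (coin_filtration k) = UNIV"
  by (simp add: coin_filtration_def)

lemma sets_coin_filtration:
  "sets (coin_filtration k) = {A. \<forall>\<omega> \<omega>'. (\<forall>i<k. \<omega> i = \<omega>' i) \<longrightarrow> (\<omega> \<in> A \<longleftrightarrow> \<omega>' \<in> A)}"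
    (is "_ = ?S")
proof -
  have "sigma_algebra UNIV ?S"
    unfolding sigma_algebra_iff2
  proof (intro conjI ballI allI impI)
    fix A :: "nat \<Rightarrow> (nat \<Rightarrow> real) set" assume "range A \<subseteq> ?S"
    then have "A i \<in> ?S" for i by blast
    then show "\<Union> (range A) \<in> ?S" by blast
  qed auto
  then show ?thesis
    unfolding coin_filtration_def
    by (subst sets_measure_of) (auto simp: sigma_algebra.sigma_sets_eq)
qed

lemma measurable_coin_filtration:
  fixes f :: "(nat \<Rightarrow> real) \<Rightarrow> real"
  assumes "\<And>\<omega> \<omega>'. (\<And>i. i < k \<Longrightarrow> \<omega> i = \<omega>' i) \<Longrightarrow> f \<omega> = f \<omega>'"
  shows "f \<in> borel_measurable (coin_filtration k)"
proof (rule measurableI)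
  fix A :: "real set"
  show "f -` A \<inter> space (coin_filtration k) \<in> sets (coin_filtration k)"
    unfolding sets_coin_filtration mem_Collect_eq space_coin_filtration Int_UNIV_right vimage_def
    by (metis assms)
qed simp

lemma filtration_coin: "filtration_upto (measure_pmf p) n coin_filtration"
proof -
  have "sets (coin_filtration j) \<subseteq> sets (coin_filtration k)" if "j \<le> k" for j k
    unfolding sets_coin_filtration using order_less_le_trans[OF _ that] by blast
  then show ?thesis by (simp add: filtration_upto_def subalgebra_def)
qed

section \<open>The walk as a martingale and its hitting probability\<close>

context
  fixes s :: "nat \<Rightarrow> real \<Rightarrow> real" and n :: nat and x :: real
begin

primrec walk :: "nat \<Rightarrow> (nat \<Rightarrow> real) \<Rightarrow> real" where
  "walk 0 \<omega> = x"
\<comment> \<open>Before this move \<open>n - k\<close> steps remain, hence the index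
  \<open>n - Suc k\<close> in \<open>s\<close>.\<close>
| "walk (Suc k) \<omega> = walk k \<omega> + s (n - Suc k) (walk k \<omega>) * \<omega> k"

lemma walk_cong: "(\<And>i. i < k \<Longrightarrow> \<omega> i = \<omega>' i) \<Longrightarrow> walk k \<omega> = walk k \<omega>'"
  by (induction k) auto

lemma walk_flip: "walk k (flip k \<omega>) = walk k \<omega>"
  by (rule walk_cong) (simp add: flip_def)

lemma martingale_walk: "martingale_upto (measure_pmf (signs_pmf n)) n coin_filtration walk"
  unfolding martingale_upto_def
proof (intro conjI allI impI)
  show "prob_space (measure_pmf (signs_pmf n))" by (rule prob_space_measure_pmf)
  show "filtration_upto (measure_pmf (signs_pmf n)) n coin_filtration" by (rule filtration_coin)
next
  fix k
  show "walk k \<in> borel_measurable (coin_filtration k)"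
    by (intro measurable_coin_filtration walk_cong)
  show "integrable (measure_pmf (signs_pmf n)) (walk k)" by simp
next
  fix k assume "k < n"
  interpret finite_measure_subalgebra "measure_pmf (signs_pmf n)" "coin_filtration k"
    using filtration_coin[of "signs_pmf n" k]
    by unfold_locales (auto simp: filtration_upto_def)
  show "AE \<omega> in measure_pmf (signs_pmf n).
      real_cond_exp (measure_pmf (signs_pmf n)) (coin_filtration k) (walk (Suc k)) \<omega> = walk k \<omega>"
  proof (rule real_cond_exp_charact)
    fix A assume "A \<in> sets (coin_filtration k)"
    then have A: "indicator A (flip k \<omega>) = (indicator A \<omega> :: real)" for \<omega>
      unfolding sets_coin_filtration
      by (auto simp: flip_def indicator_def)
         (metis fun_upd_other nat_neq_iff)+
    \<comment> \<open>\<open>A\<close> and \<open>walk k\<close> depend only on signs before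
      \<open>k\<close>, so the increment over \<open>A\<close> is odd under \<open>flip k\<close>
      and has mean 0.\<close>
    let ?d = "\<lambda>\<omega>. indicator A \<omega> * (s (n - Suc k) (walk k \<omega>) * \<omega> k)"
    have "measure_pmf.expectation (signs_pmf n) ?d
        = measure_pmf.expectation (signs_pmf n) (\<lambda>\<omega>. ?d (flip k \<omega>))"
      by (rule expectation_flip[symmetric])
    also have "\<dots> = measure_pmf.expectation (signs_pmf n) (\<lambda>\<omega>. - ?d \<omega>)"
      by (simp add: A walk_flip) (simp add: flip_def)
    finally have "measure_pmf.expectation (signs_pmf n) ?d = 0" by simp
    then show "(LINT \<omega>:A|measure_pmf (signs_pmf n). walk (Suc k) \<omega>)
        = (LINT \<omega>:A|measure_pmf (signs_pmf n). walk k \<omega>)"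
      by (simp add: set_lebesgue_integral_def distrib_left)
  qed (auto intro!: measurable_coin_filtration walk_cong)
qed

lemma cond_exp_walk_increment_square:
  assumes "k < n"
  shows "AE \<omega> in measure_pmf (signs_pmf n).
    real_cond_exp (measure_pmf (signs_pmf n)) (coin_filtration k)
      (\<lambda>\<omega>. (walk (Suc k) \<omega> - walk k \<omega>)\<^sup>2) \<omega> = (s (n - Suc k) (walk k \<omega>))\<^sup>2"
proof -
  let ?P = "measure_pmf (signs_pmf n)" and ?q = "\<lambda>\<omega>. (s (n - Suc k) (walk k \<omega>))\<^sup>2"
  interpret finite_measure_subalgebra ?P "coin_filtration k"
    using filtration_coin[of "signs_pmf n" k]
    by unfold_locales (auto simp: filtration_upto_def)
  have "AE \<omega> in ?P. real_cond_exp ?P (coin_filtration k)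
      (\<lambda>\<omega>. (walk (Suc k) \<omega> - walk k \<omega>)\<^sup>2) \<omega> = real_cond_exp ?P (coin_filtration k) ?q \<omega>"
  proof (rule real_cond_exp_cong)
    have "(\<omega> k)\<^sup>2 = 1" if "\<omega> \<in> sign_vectors n" for \<omega>
    proof -
      have "\<bar>\<omega> k\<bar> = 1" using that assms by (simp add: sign_vectors_def)
      then have "\<bar>\<omega> k\<bar>\<^sup>2 = 1" by (simp only: one_power2)
      then show ?thesis by (simp only: power2_abs)
    qed
    then show "AE \<omega> in ?P. (walk (Suc k) \<omega> - walk k \<omega>)\<^sup>2 = ?q \<omega>"
      by (simp add: AE_measure_pmf_iff set_signs_pmf power_mult_distrib)
  qed auto
  moreover have "AE \<omega> in ?P. real_cond_exp ?P (coin_filtration k) ?q \<omega> = ?q \<omega>"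
  proof (rule real_cond_exp_F_meas)
    show "?q \<in> borel_measurable (coin_filtration k)"
      by (rule measurable_coin_filtration) (metis walk_cong)
  qed simp
  ultimately show ?thesis by eventually_elim simp
qed

text \<open>Evaluated along the walk, \<open>win_prob\<close> keeps its mean; the case
  \<open>k = n\<close> turns the recursion into the probability of ending at 0.\<close>

lemma expectation_win_prob_walk:
  assumes "k \<le> n"
  shows "measure_pmf.expectation (signs_pmf n) (\<lambda>\<omega>. win_prob s (n - k) (walk k \<omega>)) = win_prob s n x"
  using assms
proof (induction k)
  case (Suc k)
  let ?E = "measure_pmf.expectation (signs_pmf n)"
  let ?t = "n - Suc k"
  have t: "n - k = Suc ?t" using Suc.prems by simp
  define g where "g \<omega> = win_prob s ?t (walk (Suc k) \<omega>)" for \<omega>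
  \<comment> \<open>A vector and its flip realise the two branches in the recursion of
    \<open>win_prob\<close>.\<close>
  have "g \<omega> + g (flip k \<omega>) = 2 * win_prob s (n - k) (walk k \<omega>)" if "\<omega> \<in> sign_vectors n" for \<omega>
  proof -
    have "\<bar>\<omega> k\<bar> = 1" using that Suc.prems by (simp add: sign_vectors_def)
    then consider "\<omega> k = 1" | "\<omega> k = - 1" by linarith
    then show ?thesis
      unfolding t g_def by cases (simp_all add: walk_flip, simp_all add: flip_def)
  qed
  then have "?E (\<lambda>\<omega>. g \<omega> + g (flip k \<omega>)) = ?E (\<lambda>\<omega>. 2 * win_prob s (n - k) (walk k \<omega>))"
    by (intro integral_cong_AE) (auto simp: AE_measure_pmf_iff set_signs_pmf)
  moreover have "?E (\<lambda>\<omega>. g \<omega> + g (flip k \<omega>)) = 2 * ?E g"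
    by (simp add: expectation_flip)
  ultimately show ?case
    using Suc unfolding g_def by simp
qed simp

lemma prob_walk_eq_0:
  "measure (measure_pmf (signs_pmf n)) {\<omega>. walk n \<omega> = 0} = win_prob s n x"
proof -
  have "win_prob s n x = measure_pmf.expectation (signs_pmf n) (indicator {\<omega>. walk n \<omega> = 0})"
    unfolding expectation_win_prob_walk[OF order_refl, symmetric]
    by (intro Bochner_Integration.integral_cong) (auto simp: indicator_def)
  then show ?thesis by simp
qed

end

theorem lemma1p3:
  shows "\<exists>c::real. c > 0 \<and>
    (\<forall>n::nat. n \<ge> 3 \<longrightarrow>
      (\<exists>(P :: (nat \<Rightarrow> real) measure) (F :: nat \<Rightarrow> (nat \<Rightarrow> real) measure)
         (M :: nat \<Rightarrow> (nat \<Rightarrow> real) \<Rightarrow> real).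
        martingale_upto P n F M \<and>
        (\<forall>k<n. AE \<omega> in P.
           real_cond_exp P (F k) (\<lambda>\<omega>. (M (Suc k) \<omega> - M k \<omega>)\<^sup>2) \<omega> \<ge> 1 \<and>
           \<bar>M (Suc k) \<omega> - M k \<omega>\<bar> \<le> ln (real n)) \<and>
        measure P {\<omega> \<in> space P. M n \<omega> = 0} \<ge> c))"
proof -
  obtain c :: real where "0 < c"
    and c: "\<And>n. 3 \<le> n \<Longrightarrow> \<exists>u x. achievable (ln (real n)) n u \<and> c \<le> u x"
    using ex_uniform_bound by blast
  show ?thesis
  proof (rule exI[of _ c], intro conjI allI impI)
    fix n :: nat assume "3 \<le> n"
    then obtain u x where "achievable (ln (real n)) n u" "c \<le> u x" using c by blast
    then obtain s where s: "\<And>k y. 1 \<le> s k y \<and> s k y \<le> ln (real n)" and "c \<le> win_prob s n x"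
      unfolding achievable_def by (meson order_trans)
    let ?P = "measure_pmf (signs_pmf n)" and ?M = "walk s n x"
    have sq: "1 \<le> (s k y)\<^sup>2" for k y using s[of k y] by (simp add: one_le_power)
    have "AE \<omega> in ?P. real_cond_exp ?P (coin_filtration k) (\<lambda>\<omega>. (?M (Suc k) \<omega> - ?M k \<omega>)\<^sup>2) \<omega> \<ge> 1 \<and>
        \<bar>?M (Suc k) \<omega> - ?M k \<omega>\<bar> \<le> ln (real n)" if "k < n" for k
    proof -
      have "AE \<omega> in ?P. \<bar>\<omega> k\<bar> = 1"
        using that by (simp add: AE_measure_pmf_iff set_signs_pmf sign_vectors_def)
      with cond_exp_walk_increment_square[OF that, of s x] show ?thesis
      proof eventually_elim
        case (elim \<omega>)
        have "\<bar>s (n - Suc k) (?M k \<omega>) * \<omega> k\<bar> \<le> ln (real n)"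
          using s[of "n - Suc k" "?M k \<omega>"] elim(2) by (simp add: abs_mult)
        then show ?case using elim(1) sq by simp
      qed
    qed
    moreover have "c \<le> measure ?P {\<omega> \<in> space ?P. ?M n \<omega> = 0}"
      using \<open>c \<le> win_prob s n x\<close> by (simp add: prob_walk_eq_0)
    ultimately show "\<exists>(P :: (nat \<Rightarrow> real) measure) (F :: nat \<Rightarrow> (nat \<Rightarrow> real) measure)
         (M :: nat \<Rightarrow> (nat \<Rightarrow> real) \<Rightarrow> real).
        martingale_upto P n F M \<and>
        (\<forall>k<n. AE \<omega> in P.
           real_cond_exp P (F k) (\<lambda>\<omega>. (M (Suc k) \<omega> - M k \<omega>)\<^sup>2) \<omega> \<ge> 1 \<and>
           \<bar>M (Suc k) \<omega> - M k \<omega>\<bar> \<le> ln (real n)) \<and>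
        measure P {\<omega> \<in> space P. M n \<omega> = 0} \<ge> c"
      using martingale_walk[of n s x] by blast
  qed (fact \<open>0 < c\<close>)
qed

end
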